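(* Let $g(z)=\sum_{n=0}^{\infty} b_n z^n$ be analytic in the unit disc $\mathbb{D}$. Let $0<\alpha<2$ and $\beta\in\mathbb{R}$. Then the following conditions are equivalent: (1) The operator $\mathcal{H}_g:\mathcal{D}^2_\alpha\to\mathcal{D}^2_\beta$ is bounded. (2) $\displaystyle\sum_{n=2^N-1}^{2^{N+1}}|b_{n+1}|^2=O\left(2^{N(\beta-\alpha-1)}\right)$ as $N\to\infty$.
   Context: $\mathbb{D}$ is the open unit disc of $\mathbb{C}$ and $H(\mathbb{D})$ is the space of all analytic functions in $\mathbb{D}$. For $g\in H(\mathbb{D})$ the generalized Hilbert operator is $\mathcal{H}_g(f)(z)=\int_0^1 f(t)g'(tz)\,dt$, $z\in\mathbb{D}$, for $f\in H(\mathbb{D})$ with $\int_0^1|f(t)|\,dt<\infty$ (this holds for every $f\in\mathcal{D}^2_\alpha$ when $\alpha<2$). For $\gamma\in\mathbb{R}$, $\mathcal{D}^2_\gamma$ is the space of $h(z)=\sum_{n\ge0}c_nz^n\in H(\mathbb{D})$ with $\|h\|^2_{\mathcal{D}^2_\gamma}=|c_0|^2+\sum_{n=1}^\infty n^{1-\gamma}|c_n|^2<\infty$. *)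

theory Defs
  imports
    "HOL-Complex_Analysis.Complex_Analysis"
    "HOL-Library.Landau_Symbols"
begin

text \<open>
  Functions on the unit disc are total functions of type \<^typ>\<open>complex \<Rightarrow> complex\<close>; their
  values off \<^term>\<open>ball (0::complex) 1\<close> are never used.
\<close>

definition taylor_coeff :: "(complex \<Rightarrow> complex) \<Rightarrow> nat \<Rightarrow> complex" where
  "taylor_coeff h n = fps_nth (fps_expansion h 0) n"

definition D2 :: "real \<Rightarrow> (complex \<Rightarrow> complex) set" where
  "D2 \<gamma> = {h. h holomorphic_on ball 0 1 \<and>
              summable (\<lambda>n. real (Suc n) powr (1 - \<gamma>) * (cmod (taylor_coeff h (Suc n)))\<^sup>2)}"

definition D2_norm :: "real \<Rightarrow> (complex \<Rightarrow> complex) \<Rightarrow> real" where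
  "D2_norm \<gamma> h = sqrt ((cmod (taylor_coeff h 0))\<^sup>2 +
     (\<Sum>n. real (Suc n) powr (1 - \<gamma>) * (cmod (taylor_coeff h (Suc n)))\<^sup>2))"

text \<open>
  The interval is half-open because \<^term>\<open>f 1\<close> is not a value of \<open>f\<close> on the disc. The integral
  is the Lebesgue integral, meaningful when \<open>f\<close> is absolutely integrable on \<open>[0,1)\<close>;
  every \<open>f \<in> D2 \<alpha>\<close> with \<open>\<alpha> < 2\<close> is, by the Cauchy-Schwarz inequality applied to
  \<open>\<Sum>n. cmod (c n) / (n + 1)\<close>, where \<open>c n\<close> are the Taylor coefficients of \<open>f\<close>.
\<close>

definition hilbert_op :: "(complex \<Rightarrow> complex) \<Rightarrow> (complex \<Rightarrow> complex) \<Rightarrow> complex \<Rightarrow> complex" where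
  "hilbert_op g f z = (LINT t:{0..<1}|lborel. f (of_real t) * deriv g (of_real t * z))"

definition bounded_D2_operator ::
    "real \<Rightarrow> real \<Rightarrow> ((complex \<Rightarrow> complex) \<Rightarrow> (complex \<Rightarrow> complex)) \<Rightarrow> bool" where
  "bounded_D2_operator \<alpha> \<beta> T \<longleftrightarrow>
     (\<forall>f\<in>D2 \<alpha>. T f \<in> D2 \<beta>) \<and>
     (\<exists>C. \<forall>f\<in>D2 \<alpha>. D2_norm \<beta> (T f) \<le> C * D2_norm \<alpha> f)"

end

theory Submission
  imports Defs
begin

text \<open>
  If \<open>f\<close> has Taylor coefficients \<open>a k\<close>, then \<open>hilbert_op g f\<close> has the coefficients
  \<open>(n + 1) * b (n + 1) * m n\<close> with the moments \<open>m n = (\<Sum>k. a k / (n + k + 1))\<close>.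
  Testing on \<open>\<Sum>z ^ k\<close> over the dyadic block of \<open>N\<close>, for which \<open>m n\<close> is bounded below when \<open>n\<close> is
  of size \<open>2 ^ N\<close>, shows that the coefficient condition is necessary. For the converse,
  Cauchy-Schwarz with the weight \<open>(k + 1) powr (-s)\<close>, \<open>s = 1 - \<alpha> / 2\<close>, bounds \<open>\<bar>m n\<bar>\<^sup>2\<close> by
  \<open>(n + 1) powr (-s)\<close> times \<open>\<Sum>k. \<bar>a k\<bar>\<^sup>2 * (k + 1) powr s / (n + k + 1)\<close>; after interchanging
  the sums over \<open>n\<close> and \<open>k\<close>, the block condition controls the inner sum over \<open>n\<close>.
\<close>

subsection \<open>Taylor coefficients of the Hilbert operator\<close>

text \<open>A power series converging on the disc has a positive radius of convergence and is
  therefore the expansion of its sum at 0. This is how coefficients are read off, both for the image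
  under the operator and for the test polynomials.\<close>

lemma taylor_coeff_unique:
  assumes "\<And>z. z \<in> ball 0 1 \<Longrightarrow> (\<lambda>n. c n * z ^ n) sums h z"
  shows "h holomorphic_on ball 0 1" and "taylor_coeff h = c"
proof -
  have s: "(\<lambda>n. fps_nth (Abs_fps c) n * z ^ n) sums h z" if "z \<in> ball 0 1" for z
    using assms[OF that] by simp
  show "h holomorphic_on ball 0 1"
    by (rule power_series_holomorphic[where a = c]) (use assms in auto)
  \<comment> \<open>Convergence at one nonzero point, here 1/2, already makes the radius of
    convergence positive.\<close>
  have sm: "summable (\<lambda>n. fps_nth (Abs_fps c) n * (1/2) ^ n)"
    using s[of "1/2"] by (auto simp: sums_iff)
  have "fps_conv_radius (Abs_fps c) \<ge> ereal (norm (1/2 :: complex))"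
    unfolding fps_conv_radius_def by (rule conv_radius_geI[OF sm])
  then have "fps_conv_radius (Abs_fps c) > 0"
    by (rule less_le_trans[rotated]) auto
  moreover have "eventually (\<lambda>z. eval_fps (Abs_fps c) z = h z) (nhds 0)"
    by (rule eventually_mono[OF eventually_nhds_in_open[of "ball 0 1"]])
      (use s in \<open>auto simp: eval_fps_def sums_iff\<close>)
  ultimately have "h has_fps_expansion Abs_fps c"
    by (simp add: has_fps_expansion_def)
  then show "taylor_coeff h = c"
    by (auto simp: taylor_coeff_def fun_eq_iff dest: fps_expansion_eqI)
qed

lemma taylor_coeff_sums:
  assumes "h holomorphic_on ball 0 1" "z \<in> ball 0 1"
  shows "(\<lambda>n. taylor_coeff h n * z ^ n) sums h z"
  using holomorphic_power_series[OF assms] by (simp add: taylor_coeff_def fps_expansion_def)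

section \<open>Moments on the unit interval and termwise integration\<close>

text \<open>As a measure of its own, without indicator functions in the integrands, the interval
  fits the Bochner integral theorems on series directly.\<close>

definition unit_lborel :: "real measure" where "unit_lborel = restrict_space lborel {0..<1}"

lemma hilbert_op_eq: "hilbert_op g f z = (\<integral>t. f (of_real t) * deriv g (of_real t * z) \<partial>unit_lborel)"
  unfolding hilbert_op_def unit_lborel_def
  by (simp add: set_lebesgue_integral_def integral_restrict_space)

lemma space_unit_lborel [simp]: "space unit_lborel = {0..<1}"
  by (simp add: unit_lborel_def space_restrict_space)

lemma integrable_unit_lborel_power: "integrable unit_lborel (\<lambda>t. t ^ n)"
  and integral_unit_lborel_power: "(\<integral>t. t ^ n \<partial>unit_lborel) = 1 / (real n + 1)"
proof -
  \<comment> \<open>The known integral of a power is over the closed interval; the two integrands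
    differ only at the null point 1.\<close>
  have ae: "AE t in lborel. indicator {0..1} t *\<^sub>R t ^ n = indicator {0..<1} t *\<^sub>R (t::real) ^ n"
    using AE_lborel_singleton[of 1] by eventually_elim (auto split: split_indicator)
  have int: "integrable lborel (\<lambda>t::real. indicator {0..1} t *\<^sub>R t ^ n)"
    by (rule borel_integrable_atLeastAtMost'[unfolded set_integrable_def]) (auto intro!: continuous_intros)
  have "integrable lborel (\<lambda>t::real. indicator {0..<1} t *\<^sub>R t ^ n)"
    by (rule integrable_cong_AE_imp[OF int _ ae]) simp
  then show "integrable unit_lborel (\<lambda>t. t ^ n)"
    by (simp add: unit_lborel_def integrable_restrict_space set_integrable_def)
  have "(\<integral>t. t ^ n \<partial>unit_lborel) = (\<integral>t. indicator {0..<1} t *\<^sub>R t ^ n \<partial>lborel)"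
    by (simp add: unit_lborel_def integral_restrict_space)
  also have "\<dots> = (\<integral>t. indicator {0..1} t *\<^sub>R t ^ n \<partial>lborel)"
    by (rule integral_cong_AE[OF _ _ ae, symmetric]) simp_all
  also have "\<dots> = 1 / (real n + 1)"
    using integral_power[of 0 1 n] by (simp add: mult.commute)
  finally show "(\<integral>t. t ^ n \<partial>unit_lborel) = 1 / (real n + 1)" .
qed

text \<open>Row \<open>n\<close> of the Hilbert matrix applied to \<open>a\<close>; for suitable
  \<open>a\<close> it is the integral of \<open>f t * t ^ n\<close> over \<open>[0,1)\<close>, where
  \<open>f\<close> has the coefficients \<open>a\<close>.\<close>

definition moment :: "(nat \<Rightarrow> complex) \<Rightarrow> nat \<Rightarrow> complex" where
  "moment a n = (\<Sum>k. a k / (of_nat n + of_nat k + 1))"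

text \<open>The series is integrated term by term: the norms of its terms have the integrals
  \<open>cmod (a k) / (n + k + 1)\<close>, which the summability hypothesis dominates.\<close>

lemma moment_integral:
  fixes f :: "complex \<Rightarrow> complex"
  assumes f: "\<And>t. 0 \<le> t \<Longrightarrow> t < 1 \<Longrightarrow> (\<lambda>k. a k * of_real t ^ k) sums f (of_real t)"
    and a: "summable (\<lambda>k. cmod (a k) / (real k + 1))"
  shows "integrable unit_lborel (\<lambda>t. f (of_real t) * of_real t ^ n)"
    and "(\<integral>t. f (of_real t) * of_real t ^ n \<partial>unit_lborel) = moment a n"
proof -
  define u where "u = (\<lambda>k (t::real). a k * of_real (t ^ (n + k)))"
  have u: "integrable unit_lborel (u k)" "integral\<^sup>L unit_lborel (u k) = a k / (of_nat n + of_nat k + 1)" for k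
  proof -
    have i: "integrable unit_lborel (\<lambda>t. complex_of_real (t ^ (n + k)))"
      by (rule integrable_of_real[OF integrable_unit_lborel_power])
    then show "integrable unit_lborel (u k)" unfolding u_def by (rule integrable_mult_right)
    have "integral\<^sup>L unit_lborel (u k) = a k * of_real (\<integral>t. t ^ (n + k) \<partial>unit_lborel)"
      unfolding u_def by (simp only: integral_mult_right_zero integral_complex_of_real)
    then show "integral\<^sup>L unit_lborel (u k) = a k / (of_nat n + of_nat k + 1)"
      by (simp only: integral_unit_lborel_power) simp
  qed
  have nrm: "(\<integral>t. norm (u k t) \<partial>unit_lborel) = cmod (a k) / (real n + real k + 1)" for k
  proof -
    have "(\<integral>t. norm (u k t) \<partial>unit_lborel) = (\<integral>t. cmod (a k) * t ^ (n + k) \<partial>unit_lborel)"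
      by (rule Bochner_Integration.integral_cong) (auto simp: u_def norm_mult norm_power)
    then show ?thesis by (simp only: integral_mult_right_zero integral_unit_lborel_power) simp
  qed
  have usum: "(\<lambda>k. u k t) sums (f (of_real t) * of_real t ^ n)" if "0 \<le> t" "t < 1" for t
    using sums_mult2[OF f[OF that], of "of_real t ^ n"]
    by (simp add: u_def power_add mult_ac)
  have ae: "AE t in unit_lborel. summable (\<lambda>k. norm (u k t))"
  proof (rule AE_I2)
    fix t assume "t \<in> space unit_lborel"
    then have t: "0 \<le> t" "t < 1" by auto
    \<comment> \<open>Convergence at a point strictly between \<open>t\<close> and 1 gives absolute
      convergence at \<open>t\<close>.\<close>
    define r where "r = (t + 1) / 2"
    have r: "t < r" "r < 1" "0 \<le> r" using t by (auto simp: r_def)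
    have "summable (\<lambda>k. a k * of_real r ^ k)"
      using f[of r] r by (auto simp: sums_iff)
    then have "summable (\<lambda>k. norm (a k * of_real t ^ k))"
      by (rule powser_insidea) (use r t in auto)
    then have "summable (\<lambda>k. norm (a k * of_real t ^ k) * norm (of_real t ^ n :: complex))"
      by (rule summable_mult2)
    then show "summable (\<lambda>k. norm (u k t))"
      by (simp add: u_def power_add norm_mult norm_power mult_ac)
  qed
  have sm: "summable (\<lambda>k. \<integral>t. norm (u k t) \<partial>unit_lborel)"
    unfolding nrm
    by (rule summable_comparison_test[OF _ a]) (auto intro!: exI[of _ 0] divide_left_mono)
  note * = u(1) ae sm
  have eq: "(\<Sum>k. u k t) = f (of_real t) * of_real t ^ n" if "t \<in> space unit_lborel" for t
    using usum[of t] that by (auto simp: sums_iff)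
  show "integrable unit_lborel (\<lambda>t. f (of_real t) * of_real t ^ n)"
    using integrable_suminf[OF *] by (subst Bochner_Integration.integrable_cong[OF refl eq[symmetric]]) auto
  have "(\<integral>t. f (of_real t) * of_real t ^ n \<partial>unit_lborel) = (\<integral>t. (\<Sum>k. u k t) \<partial>unit_lborel)"
    by (intro Bochner_Integration.integral_cong refl) (use eq in auto)
  then show "(\<integral>t. f (of_real t) * of_real t ^ n \<partial>unit_lborel) = moment a n"
    by (simp add: integral_suminf[OF *] u(2) moment_def)
qed

text \<open>Expanding \<open>deriv g (t * z)\<close> in powers of \<open>t * z\<close> leaves the
  moments of \<open>f\<close> as factors. Termwise integration is allowed because the terms are
  dominated by a summable sequence times the integrable function \<open>norm (f t)\<close>.\<close>

lemma hilbert_op_sums: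
  assumes g: "\<And>z. z \<in> ball 0 1 \<Longrightarrow> (\<lambda>n. b n * z ^ n) sums g z"
    and f: "\<And>z. z \<in> ball 0 1 \<Longrightarrow> (\<lambda>k. a k * z ^ k) sums f z"
    and a: "summable (\<lambda>k. cmod (a k) / (real k + 1))"
    and z: "z \<in> ball 0 1"
  shows "(\<lambda>n. (of_nat (Suc n) * b (Suc n) * moment a n) * z ^ n) sums hilbert_op g f z"
proof -
  have f': "(\<lambda>k. a k * of_real t ^ k) sums f (of_real t)" if "0 \<le> t" "t < 1" for t
    using f[of "of_real t"] that by auto
  note mom = moment_integral[OF f' a]
  define d where "d = (\<lambda>n. of_nat (Suc n) * b (Suc n))"
  have g': "(\<lambda>n. d n * w ^ n) sums deriv g w" if "norm w < 1" for w
  proof -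
    have "g holomorphic_on ball 0 1" using taylor_coeff_unique(1)[OF g] .
    then have "(g has_field_derivative deriv g w) (at w)"
      using that by (intro holomorphic_derivI[of g "ball 0 1"]) auto
    then have "(\<lambda>n. diffs b n * w ^ n) sums deriv g w"
      by (rule termdiffs_sums_strong[rotated]) (use g that in auto)
    then show ?thesis by (simp add: diffs_def d_def)
  qed
  \<comment> \<open>The moment of order 0 gives the integrability of \<open>f\<close>
    itself.\<close>
  have int0: "integrable unit_lborel (\<lambda>t. norm (f (of_real t)))"
    using mom(1)[of 0] by (simp add: integrable_norm)
  define u where "u = (\<lambda>n (t::real). (d n * z ^ n) * (f (of_real t) * of_real t ^ n))"
  have u: "integrable unit_lborel (u n)" "integral\<^sup>L unit_lborel (u n) = d n * moment a n * z ^ n" for n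
    unfolding u_def using mom[of n] by (simp_all add: mult_ac)
  have dz: "summable (\<lambda>n. norm (d n * z ^ n))"
  proof -
    obtain r where r: "norm z < r" "r < 1" using z dense[of "norm z" 1] by auto
    then have "0 \<le> r" using norm_ge_zero[of z] by linarith
    have "summable (\<lambda>n. d n * of_real r ^ n)"
      using g'[of "of_real r"] r \<open>0 \<le> r\<close> by (auto simp: sums_iff)
    then show ?thesis by (rule powser_insidea) (use r \<open>0 \<le> r\<close> in auto)
  qed
  have le: "norm (u n t) \<le> norm (d n * z ^ n) * norm (f (of_real t))" if "t \<in> space unit_lborel" for n t
  proof -
    have "norm (of_real t ^ n :: complex) \<le> 1"
      using that by (auto simp: norm_power intro!: power_le_one)
    then have "norm (f (of_real t)) * norm (of_real t ^ n :: complex) \<le> norm (f (of_real t))"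
      by (simp add: mult_left_le)
    then show ?thesis
      unfolding u_def norm_mult[of "d n * z ^ n"] norm_mult[of "f _"] by (rule mult_left_mono) simp
  qed
  have ae: "AE t in unit_lborel. summable (\<lambda>n. norm (u n t))"
  proof (rule AE_I2)
    fix t assume t: "t \<in> space unit_lborel"
    show "summable (\<lambda>n. norm (u n t))"
      by (rule summable_comparison_test[OF _ summable_mult2[OF dz, of "norm (f (of_real t))"]])
        (use le[OF t] in auto)
  qed
  have sm: "summable (\<lambda>n. \<integral>t. norm (u n t) \<partial>unit_lborel)"
  proof (rule summable_comparison_test[OF _ summable_mult2[OF dz, of "\<integral>t. norm (f (of_real t)) \<partial>unit_lborel"]])
    have "(\<integral>t. norm (u n t) \<partial>unit_lborel) \<le> (\<integral>t. norm (d n * z ^ n) * norm (f (of_real t)) \<partial>unit_lborel)" for n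
      by (rule integral_mono) (use u(1)[of n] int0 le in \<open>auto intro!: integrable_norm\<close>)
    then show "\<exists>N. \<forall>n\<ge>N. norm (\<integral>t. norm (u n t) \<partial>unit_lborel) \<le> norm (d n * z ^ n) * (\<integral>t. norm (f (of_real t)) \<partial>unit_lborel)"
      using int0 by (auto simp: integral_nonneg_AE)
  qed
  have "(\<lambda>n. integral\<^sup>L unit_lborel (u n)) sums (\<integral>t. (\<Sum>n. u n t) \<partial>unit_lborel)"
    by (rule sums_integral[OF u(1) ae sm])
  also have "(\<integral>t. (\<Sum>n. u n t) \<partial>unit_lborel) = hilbert_op g f z"
    unfolding hilbert_op_eq
  proof (intro Bochner_Integration.integral_cong refl)
    fix t assume "t \<in> space unit_lborel"
    then have t: "0 \<le> t" "t < 1" by auto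
    have "norm (of_real t * z) < 1"
    proof -
      have "norm (of_real t * z) \<le> norm z" using t by (simp add: norm_mult mult_left_le_one_le)
      then show ?thesis using z by simp
    qed
    from sums_mult[OF g'[OF this], of "f (of_real t)"]
    show "(\<Sum>n. u n t) = f (of_real t) * deriv g (of_real t * z)"
      by (simp add: u_def sums_iff power_mult_distrib mult_ac)
  qed
  finally show ?thesis by (simp add: u(2) d_def)
qed

subsection \<open>The weighted Hilbert inequality\<close>

text \<open>The exponent \<open>\<bar>p\<bar>\<close> covers both signs of \<open>p\<close>: one of
  the two inequalities is always plain monotonicity, weakened by a factor that is at least 1. It
  allows a power weight to be replaced by its value at a comparable point.\<close>

lemma powr_comparable:
  fixes x y q p :: real
  assumes "0 < y" "y \<le> x" "x \<le> q * y"
  shows "x powr p \<le> q powr \<bar>p\<bar> * y powr p" and "y powr p \<le> q powr \<bar>p\<bar> * x powr p"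
proof -
  have "y \<le> q * y" using assms by linarith
  then have q: "1 \<le> q" using assms(1) by simp
  have q1: "1 \<le> q powr \<bar>p\<bar>" using q by (simp add: ge_one_powr_ge_zero)
  have up: "u \<le> q powr \<bar>p\<bar> * u" if "0 \<le> u" for u
    using mult_right_mono[OF q1 that] by simp
  have "x powr p \<le> q powr \<bar>p\<bar> * y powr p \<and> y powr p \<le> q powr \<bar>p\<bar> * x powr p"
  proof (cases "0 \<le> p")
    case True
    have "x powr p \<le> (q * y) powr p" by (rule powr_mono2) (use True assms in auto)
    also have "\<dots> = q powr \<bar>p\<bar> * y powr p" using True assms q by (simp add: powr_mult)
    finally have "x powr p \<le> q powr \<bar>p\<bar> * y powr p" .
    moreover have "y powr p \<le> x powr p" by (rule powr_mono2) (use True assms in auto)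
    ultimately show ?thesis using up[of "x powr p"] by (auto intro: order_trans)
  next
    case False
    have "y powr p = q powr \<bar>p\<bar> * (q * y) powr p"
      using False assms q by (simp add: powr_mult powr_minus field_simps)
    also have "\<dots> \<le> q powr \<bar>p\<bar> * x powr p"
      by (intro mult_left_mono powr_mono2') (use False assms in auto)
    finally have "y powr p \<le> q powr \<bar>p\<bar> * x powr p" .
    moreover have "x powr p \<le> y powr p" by (rule powr_mono2') (use False assms in auto)
    ultimately show ?thesis using up[of "y powr p"] by (auto intro: order_trans)
  qed
  then show "x powr p \<le> q powr \<bar>p\<bar> * y powr p" and "y powr p \<le> q powr \<bar>p\<bar> * x powr p" by auto
qed

section \<open>Dyadic blocks\<close>

text \<open>These blocks partition the naturals by the size of \<open>n + 1\<close>. The range of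
  summation in the theorem has two further indices, \<open>2 ^ (N + 1) - 1\<close> and
  \<open>2 ^ (N + 1)\<close>, and so overlaps the next block.\<close>

definition dyad :: "nat \<Rightarrow> nat set" where
  "dyad N = {2 ^ N - 1..<2 ^ (N + 1) - 1}"

lemma finite_dyad [simp]: "finite (dyad N)" and card_dyad [simp]: "card (dyad N) = 2 ^ N"
  by (simp_all add: dyad_def)

lemma dyadD:
  assumes "n \<in> dyad N"
  shows "2 ^ N \<le> real n + 1" "real n + 1 \<le> 2 * 2 ^ N"
proof -
  have "2 ^ N \<le> n + 1" "n + 1 \<le> 2 * 2 ^ N" using assms by (auto simp: dyad_def)
  then have "real (2 ^ N) \<le> real (n + 1)" "real (n + 1) \<le> real (2 * 2 ^ N)"
    by (simp_all only: of_nat_le_iff)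
  then show "2 ^ N \<le> real n + 1" "real n + 1 \<le> 2 * 2 ^ N" by simp_all
qed

lemma sum_dyad:
  fixes v :: "nat \<Rightarrow> real"
  shows "(\<Sum>n<2 ^ J - 1. v n) = (\<Sum>N<J. \<Sum>n\<in>dyad N. v n)"
proof (induction J)
  case (Suc J)
  have "{..<2 ^ Suc J - 1} = {..<2 ^ J - 1} \<union> dyad J" "{..<2 ^ J - 1} \<inter> dyad J = {}"
    by (auto simp: dyad_def)
  then have "(\<Sum>n<2 ^ Suc J - 1. v n) = (\<Sum>n<2 ^ J - 1. v n) + (\<Sum>n\<in>dyad J. v n)"
    by (simp add: sum.union_disjoint)
  then show ?case using Suc by simp
qed simp

lemma geometric_le:
  fixes r :: real
  assumes "0 \<le> r" "r < 1"
  shows "(\<Sum>i<n. r ^ i) \<le> 1 / (1 - r)"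
  using sum_le_suminf[of "\<lambda>i. r ^ i" "{..<n}"] suminf_geometric[of r] assms
  by (simp add: summable_geometric)

text \<open>The denominator is about \<open>x\<close> on the blocks below \<open>x\<close> and about \<open>2 ^ N\<close> on those above,
  so the block contributions decay geometrically in both directions away from \<open>x\<close>.\<close>

lemma dyadic_hilbert_sum:
  fixes v :: "nat \<Rightarrow> real" and s C :: real
  assumes s: "0 < s" "s < 1" and v: "\<And>n. 0 \<le> v n"
    and block: "\<And>N. (\<Sum>n\<in>dyad N. v n) \<le> C * 2 powr (real N * s)"
  shows "\<exists>K\<ge>0. \<forall>P x. 1 \<le> x \<longrightarrow> (\<Sum>n<P. v n / (real n + x)) \<le> K * x powr (s - 1)"
proof -
  define r where "r = 2 powr (-s)"
  define q where "q = 2 powr (s - 1)"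
  have r: "0 < r" "r < 1" using s by (auto simp: r_def powr_less_one)
  have q: "0 < q" "q < 1" using s by (auto simp: q_def powr_less_one)
  have C: "0 \<le> C"
  proof -
    have "0 \<le> (\<Sum>n\<in>dyad 0. v n)" by (intro sum_nonneg v)
    then show ?thesis using block[of 0] by simp
  qed
  define K where "K = C * (1 / (1 - r) + 1 / (1 - q))"
  have "(\<Sum>n<P. v n / (real n + x)) \<le> K * x powr (s - 1)" if x: "1 \<le> x" for P x
  proof -
    \<comment> \<open>\<open>M\<close> is the dyadic scale of \<open>x\<close>, at which the
      denominator changes its behaviour.\<close>
    obtain M :: nat where M: "2 ^ M \<le> x" "x < 2 ^ (M + 1)"
    proof -
      define M where "M = nat \<lfloor>log 2 x\<rfloor>"
      have l: "0 \<le> log 2 x" using x by simp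
      have "2 powr real M \<le> x"
        using x l by (simp add: M_def le_log_iff[symmetric])
      moreover have "log 2 x < real (M + 1)" using l by (simp add: M_def) linarith
      then have "x < 2 powr real (M + 1)"
        using x by (subst (asm) log_less_iff) auto
      ultimately show ?thesis using that[of M] by (simp only: powr_realpow zero_less_numeral)
    qed
    \<comment> \<open>Up to \<open>M\<close> the block bound \<open>2 powr (N * s)\<close> is
      divided by \<open>x\<close>, which gives powers of \<open>r\<close>; beyond \<open>M\<close>
      it is divided by \<open>2 ^ N\<close>, which gives powers of \<open>q\<close>. The latter
      start at \<open>Suc M\<close> because \<open>x < 2 ^ (M + 1)\<close>.\<close>
    define e where "e N = (if N \<le> M then r ^ (M - N) else q ^ (N - Suc M))" for N
    have block_le: "(\<Sum>n\<in>dyad N. v n / (real n + x)) \<le> C * x powr (s - 1) * e N" for N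
    proof -
      \<comment> \<open>On block \<open>N\<close> the denominator is at least \<open>x\<close>, and
        since \<open>1 \<le> x\<close> it is also at least \<open>n + 1\<close>, hence at least
        \<open>2 ^ N\<close>.\<close>
      have bl: "(\<Sum>n\<in>dyad N. v n / (real n + x)) \<le> C * (2 powr (real N * s) / y)"
        if y: "0 < y" "y \<le> max x (2 ^ N)" for y
      proof -
        have "v n / (real n + x) \<le> v n / y" if "n \<in> dyad N" for n
          using dyadD[OF that] x y by (intro divide_left_mono v) (auto simp: max_def split: if_splits)
        then have "(\<Sum>n\<in>dyad N. v n / (real n + x)) \<le> (\<Sum>n\<in>dyad N. v n) / y"
          by (subst sum_divide_distrib) (rule sum_mono)
        also have "\<dots> \<le> C * 2 powr (real N * s) / y"
          by (intro divide_right_mono block) (use y in auto)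
        finally show ?thesis by simp
      qed
      have "2 powr (real N * s) / max x (2 ^ N) \<le> x powr (s - 1) * e N"
      proof (cases "N \<le> M")
        case True
        have "2 powr (real N * s) = (2 ^ M) powr s * r ^ (M - N)"
          using True
          by (simp add: r_def powr_realpow[symmetric] powr_powr powr_add[symmetric] of_nat_diff)
             (simp add: algebra_simps)
        also have "\<dots> \<le> x powr s * r ^ (M - N)"
          using M s r by (intro mult_right_mono powr_mono2) auto
        finally have "2 powr (real N * s) / x \<le> x powr s * r ^ (M - N) / x"
          using x by (intro divide_right_mono) auto
        moreover have "2 powr (real N * s) / max x (2 ^ N) \<le> 2 powr (real N * s) / x"
          using x by (intro divide_left_mono) auto
        ultimately show ?thesis using True x by (simp add: e_def powr_diff)
      next
        case False
        have "2 powr (real N * s) / 2 ^ N = (2 ^ (M + 1)) powr (s - 1) * q ^ (N - Suc M)"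
        proof -
          have "2 powr (real N * s) / 2 ^ N = 2 powr (real N * s - real N)"
            by (simp add: powr_diff powr_realpow)
          also have "real N * s - real N = real (M + 1) * (s - 1) + real (N - Suc M) * (s - 1)"
            using False by (simp add: algebra_simps of_nat_diff)
          also have "2 powr \<dots> = 2 powr (real (M + 1) * (s - 1)) * 2 powr (real (N - Suc M) * (s - 1))"
            by (rule powr_add)
          also have "2 powr (real (M + 1) * (s - 1)) = (2 ^ (M + 1)) powr (s - 1)"
            by (simp only: powr_powr[symmetric] powr_realpow zero_less_numeral)
          also have "2 powr (real (N - Suc M) * (s - 1)) = q ^ (N - Suc M)"
            by (simp add: q_def powr_realpow[symmetric] powr_powr mult_ac)
          finally show ?thesis .
        qed
        also have "\<dots> \<le> x powr (s - 1) * q ^ (N - Suc M)"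
          using M s q x by (intro mult_right_mono powr_mono2') auto
        finally have "2 powr (real N * s) / 2 ^ N \<le> x powr (s - 1) * q ^ (N - Suc M)" .
        moreover have "2 powr (real N * s) / max x (2 ^ N) \<le> 2 powr (real N * s) / 2 ^ N"
          using x by (intro divide_left_mono) (auto simp: max_def)
        ultimately show ?thesis using False by (simp add: e_def)
      qed
      then have "C * (2 powr (real N * s) / max x (2 ^ N)) \<le> C * (x powr (s - 1) * e N)"
        using C by (rule mult_left_mono)
      moreover have "(\<Sum>n\<in>dyad N. v n / (real n + x)) \<le> C * (2 powr (real N * s) / max x (2 ^ N))"
        using x by (intro bl) (auto simp: max_def)
      ultimately show ?thesis by (simp add: mult_ac)
    qed
    have e_sum: "(\<Sum>N<J. e N) \<le> 1 / (1 - r) + 1 / (1 - q)" for J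
    proof -
      have e0: "0 \<le> e N" for N using r q by (auto simp: e_def)
      \<comment> \<open>Extending the range beyond \<open>M\<close> makes it split into two complete
        geometric pieces, whatever \<open>J\<close> is.\<close>
      have "(\<Sum>N<J. e N) \<le> (\<Sum>N<Suc M + J. e N)"
        by (rule sum_mono2) (use e0 in auto)
      also have "{..<Suc M + J} = {..M} \<union> {Suc M..<Suc M + J}" by auto
      also have "(\<Sum>N\<in>\<dots>. e N) = (\<Sum>N\<le>M. e N) + (\<Sum>N=Suc M..<Suc M + J. e N)"
        by (rule sum.union_disjoint) auto
      also have "(\<Sum>N\<le>M. e N) = (\<Sum>N<Suc M. r ^ N)"
        using sum.nat_diff_reindex[of "\<lambda>N. r ^ N" "Suc M"]
        by (simp add: e_def lessThan_Suc_atMost)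
      also have "(\<Sum>N=Suc M..<Suc M + J. e N) = (\<Sum>i<J. q ^ i)"
        using sum.shift_bounds_nat_ivl[of e 0 "Suc M" J]
        by (simp add: e_def atLeast0LessThan add.commute)
      finally show ?thesis
        using geometric_le[of r "Suc M"] geometric_le[of q J] r q by linarith
    qed
    \<comment> \<open>The first \<open>P\<close> blocks cover the first \<open>P\<close> indices,
      because \<open>P \<le> 2 ^ P - 1\<close>.\<close>
    have "(\<Sum>n<P. v n / (real n + x)) \<le> (\<Sum>n<2 ^ P - 1. v n / (real n + x))"
    proof (rule sum_mono2)
      have "P < 2 ^ P" by simp
      then have "P \<le> 2 ^ P - 1" by linarith
      then show "{..<P} \<subseteq> {..<2 ^ P - 1}" by (simp only: lessThan_subset_iff)
    qed (use v x in auto)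
    also have "\<dots> \<le> (\<Sum>N<P. C * x powr (s - 1) * e N)"
      unfolding sum_dyad by (intro sum_mono block_le)
    also have "\<dots> = C * x powr (s - 1) * (\<Sum>N<P. e N)"
      by (rule sum_distrib_left[symmetric])
    also have "\<dots> \<le> C * x powr (s - 1) * (1 / (1 - r) + 1 / (1 - q))"
      using C by (intro mult_left_mono e_sum) auto
    finally show ?thesis by (simp add: K_def mult_ac)
  qed
  moreover have "0 \<le> K" using C r q by (simp add: K_def)
  ultimately show ?thesis by blast
qed

text \<open>The preceding estimate with \<open>1 - s\<close> for \<open>s\<close>: block
  \<open>N\<close> has \<open>2 ^ N\<close> terms, each at most
  \<open>2 powr (- N * s)\<close>.\<close>

lemma hilbert_matrix_row_bound:
  fixes s :: real
  assumes s: "0 < s" "s < 1"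
  shows "\<exists>K\<ge>0. \<forall>P x. 1 \<le> x \<longrightarrow>
    (\<Sum>k<P. (real k + 1) powr (-s) / (real k + x)) \<le> K * x powr (-s)"
proof -
  have "(\<Sum>k\<in>dyad N. (real k + 1) powr (-s)) \<le> 1 * 2 powr (real N * (1 - s))" for N
  proof -
    have "(\<Sum>k\<in>dyad N. (real k + 1) powr (-s)) \<le> (\<Sum>k\<in>dyad N. (2 ^ N) powr (-s))"
      by (intro sum_mono powr_mono2') (use s dyadD(1) in auto)
    also have "\<dots> = 2 ^ N * (2 ^ N) powr (-s)" by simp
    also have "\<dots> = 2 powr (real N * (1 - s))"
      by (simp add: powr_realpow[symmetric] powr_powr powr_add[symmetric] algebra_simps)
    finally show ?thesis by simp
  qed
  from dyadic_hilbert_sum[OF _ _ _ this] show ?thesis using s by simp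
qed

text \<open>Schur's test with the test sequence \<open>(k + 1) powr (-s)\<close> for the exponent \<open>s = 1 - \<alpha> / 2\<close>,
  which is in the range where both one-sided estimates are available.\<close>

lemma hilbert_matrix_bound:
  fixes v :: "nat \<Rightarrow> real" and \<alpha> C :: real
  assumes \<alpha>: "0 < \<alpha>" "\<alpha> < 2" and v: "\<And>n. 0 \<le> v n"
    and block: "\<And>N. (\<Sum>n\<in>dyad N. v n) \<le> C * 2 powr (real N * (2 - \<alpha>))"
  obtains K where "0 \<le> K"
    and "\<And>A n. (\<And>k. 0 \<le> A k) \<Longrightarrow> summable (\<lambda>k. (real k + 1) powr (1 - \<alpha>) * (A k)\<^sup>2) \<Longrightarrow>
      summable (\<lambda>k. A k / (real n + real k + 1))"
    and "\<And>A P. (\<And>k. 0 \<le> A k) \<Longrightarrow> summable (\<lambda>k. (real k + 1) powr (1 - \<alpha>) * (A k)\<^sup>2) \<Longrightarrow>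
      (\<Sum>n<P. v n * (\<Sum>k. A k / (real n + real k + 1))\<^sup>2)
        \<le> K * (\<Sum>k. (real k + 1) powr (1 - \<alpha>) * (A k)\<^sup>2)"
proof -
  define s where "s = 1 - \<alpha> / 2"
  have s: "0 < s" "s < 1" using \<alpha> by (auto simp: s_def)
  \<comment> \<open>The factor \<open>(n + 1) powr (-s)\<close> left by the row estimate is absorbed
    into \<open>v\<close>. As 2 - \<alpha> = 2 s, the block sums of \<open>w\<close> then grow with
    exponent \<open>s\<close>, as the column estimate requires.\<close>
  define w where "w n = v n * (real n + 1) powr (-s)" for n
  obtain K1 where K1: "0 \<le> K1"
    "\<And>P x. 1 \<le> x \<Longrightarrow> (\<Sum>k<P. (real k + 1) powr (-s) / (real k + x)) \<le> K1 * x powr (-s)"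
    using hilbert_matrix_row_bound[OF s] by blast
  have w_block: "(\<Sum>n\<in>dyad N. w n) \<le> C * 2 powr (real N * s)" for N
  proof -
    have "(\<Sum>n\<in>dyad N. w n) \<le> (\<Sum>n\<in>dyad N. v n * (2 ^ N) powr (-s))"
      unfolding w_def by (intro sum_mono mult_left_mono powr_mono2' v) (use s dyadD(1) in auto)
    also have "\<dots> = (\<Sum>n\<in>dyad N. v n) * (2 ^ N) powr (-s)"
      by (rule sum_distrib_right[symmetric])
    also have "\<dots> \<le> C * 2 powr (real N * (2 - \<alpha>)) * (2 ^ N) powr (-s)"
      by (intro mult_right_mono block) simp
    also have "(2 ^ N) powr (-s) = 2 powr (real N * (-s))"
      by (simp add: powr_realpow[symmetric] powr_powr)
    also have "C * 2 powr (real N * (2 - \<alpha>)) * 2 powr (real N * (-s)) = C * 2 powr (real N * s)"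
      by (simp add: powr_add[symmetric] s_def algebra_simps)
    finally show ?thesis .
  qed
  have w0: "0 \<le> w n" for n using v by (simp add: w_def)
  obtain K2 where K2: "0 \<le> K2"
    "\<And>P x. 1 \<le> x \<Longrightarrow> (\<Sum>n<P. w n / (real n + x)) \<le> K2 * x powr (s - 1)"
    using dyadic_hilbert_sum[OF s w0 w_block] by blast
  have main: "summable (\<lambda>k. A k / (real n + real k + 1)) \<and>
      (\<Sum>n<P. v n * (\<Sum>k. A k / (real n + real k + 1))\<^sup>2)
        \<le> K1 * K2 * (\<Sum>k. (real k + 1) powr (1 - \<alpha>) * (A k)\<^sup>2)"
    if A: "\<And>k. 0 \<le> A k" and sm: "summable (\<lambda>k. (real k + 1) powr (1 - \<alpha>) * (A k)\<^sup>2)" for A n P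
  proof -
    define B where "B n k = (A k)\<^sup>2 * (real k + 1) powr s / (real n + real k + 1)" for n k
    have B0: "0 \<le> B n k" for n k by (simp add: B_def)
    \<comment> \<open>Dropping \<open>n\<close> from the denominator leaves the exponent
      \<open>s - 1\<close>, that is -\<alpha>/2, which is at most 1 - \<alpha> because \<alpha> <
      2.\<close>
    have B_sm: "summable (B n)" for n
    proof (rule summable_comparison_test[OF _ sm], intro exI[of _ 0] allI impI)
      fix k
      have "(real k + 1) powr s / (real n + real k + 1) \<le> (real k + 1) powr s / (real k + 1)"
        by (intro divide_left_mono) auto
      also have "\<dots> = (real k + 1) powr (s - 1)" by (simp add: powr_diff)
      also have "\<dots> \<le> (real k + 1) powr (1 - \<alpha>)"
        using \<alpha> by (intro powr_mono) (auto simp: s_def)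
      finally have "(A k)\<^sup>2 * ((real k + 1) powr s / (real n + real k + 1))
          \<le> (A k)\<^sup>2 * (real k + 1) powr (1 - \<alpha>)"
        by (rule mult_left_mono) simp
      then show "norm (B n k) \<le> (real k + 1) powr (1 - \<alpha>) * (A k)\<^sup>2"
        using B0[of n k] by (simp add: B_def mult_ac)
    qed
    define T where "T n = K1 * (real n + 1) powr (-s) * (\<Sum>k. B n k)" for n
    have T0: "0 \<le> T n" for n unfolding T_def
      by (intro mult_nonneg_nonneg K1(1) suminf_nonneg B_sm B0) auto
    \<comment> \<open>Cauchy-Schwarz is applied to finite sums, so that the bound, uniform in
      \<open>Q\<close>, also yields the convergence of the full row.\<close>
    have partial: "(\<Sum>k<Q. A k / (real n + real k + 1)) \<le> sqrt (T n)" for n Q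
    proof (rule real_le_rsqrt)
      let ?p = "\<lambda>k. sqrt ((real k + 1) powr (-s) / (real k + (real n + 1)))"
      let ?q = "\<lambda>k. A k * sqrt ((real k + 1) powr s / (real n + real k + 1))"
      have "A k / (real n + real k + 1) = ?p k * ?q k" for k
      proof -
        have "?p k * ?q k = A k * sqrt ((real k + 1) powr (-s) * (real k + 1) powr s
            / (real n + real k + 1)\<^sup>2)"
          by (simp add: real_sqrt_mult[symmetric] power2_eq_square add_ac)
        then show ?thesis by (simp add: powr_add[symmetric] real_sqrt_divide)
      qed
      then have "(\<Sum>k<Q. A k / (real n + real k + 1))\<^sup>2 = (\<Sum>k<Q. ?p k * ?q k)\<^sup>2" by simp
      also have "\<dots> \<le> (\<Sum>k<Q. (?p k)\<^sup>2) * (\<Sum>k<Q. (?q k)\<^sup>2)" by (rule Cauchy_Schwarz_ineq_sum)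
      also have "(\<Sum>k<Q. (?p k)\<^sup>2) = (\<Sum>k<Q. (real k + 1) powr (-s) / (real k + (real n + 1)))"
        by (intro sum.cong refl real_sqrt_pow2) simp
      also have "(\<Sum>k<Q. (?q k)\<^sup>2) = (\<Sum>k<Q. B n k)"
        by (intro sum.cong refl) (simp add: B_def power_mult_distrib)
      also have "(\<Sum>k<Q. (real k + 1) powr (-s) / (real k + (real n + 1))) * (\<Sum>k<Q. B n k)
          \<le> K1 * (real n + 1) powr (-s) * (\<Sum>k. B n k)"
        using K1 by (intro mult_mono sum_le_suminf B_sm B0 sum_nonneg) auto
      finally show "(\<Sum>k<Q. A k / (real n + real k + 1))\<^sup>2 \<le> T n" by (simp add: T_def)
    qed
    have sm': "summable (\<lambda>k. A k / (real n + real k + 1))" for n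
      by (rule summableI_nonneg_bounded[OF _ partial]) (use A in auto)
    have sq: "(\<Sum>k. A k / (real n + real k + 1))\<^sup>2 \<le> T n" for n
    proof -
      have "(\<Sum>k. A k / (real n + real k + 1)) \<le> sqrt (T n)"
        by (rule suminf_le_const[OF sm' partial])
      moreover have "0 \<le> (\<Sum>k. A k / (real n + real k + 1))"
        by (rule suminf_nonneg[OF sm']) (use A in auto)
      ultimately have "(\<Sum>k. A k / (real n + real k + 1))\<^sup>2 \<le> (sqrt (T n))\<^sup>2"
        by (rule power_mono)
      then show ?thesis using T0[of n] by simp
    qed
    have "(\<Sum>n<P. v n * (\<Sum>k. A k / (real n + real k + 1))\<^sup>2) \<le> (\<Sum>n<P. v n * T n)"
      by (intro sum_mono mult_left_mono sq v)
    also have "\<dots> = K1 * (\<Sum>n<P. \<Sum>k. w n * B n k)"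
      unfolding suminf_mult[OF B_sm] T_def w_def sum_distrib_left by (simp only: mult_ac)
    \<comment> \<open>Only finitely many \<open>n\<close> occur, so the interchange needs no more
      than summability in \<open>k\<close> for each of them.\<close>
    also have "(\<Sum>n<P. \<Sum>k. w n * B n k) = (\<Sum>k. \<Sum>n<P. w n * B n k)"
      by (intro suminf_sum[symmetric] summable_mult B_sm)
    also have "\<dots> \<le> (\<Sum>k. K2 * ((real k + 1) powr (1 - \<alpha>) * (A k)\<^sup>2))"
    proof (rule suminf_le)
      fix k
      have "(\<Sum>n<P. w n * B n k) = (A k)\<^sup>2 * (real k + 1) powr s * (\<Sum>n<P. w n / (real n + (real k + 1)))"
        by (simp add: B_def sum_distrib_left mult_ac add_ac)
      also have "\<dots> \<le> (A k)\<^sup>2 * (real k + 1) powr s * (K2 * (real k + 1) powr (s - 1))"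
        by (intro mult_left_mono K2(2)) auto
      also have "\<dots> = K2 * ((real k + 1) powr (s + (s - 1)) * (A k)\<^sup>2)"
        unfolding powr_add by (simp only: mult_ac)
      also have "s + (s - 1) = 1 - \<alpha>" by (simp add: s_def)
      finally show "(\<Sum>n<P. w n * B n k) \<le> K2 * ((real k + 1) powr (1 - \<alpha>) * (A k)\<^sup>2)" .
    qed (intro summable_sum summable_mult B_sm sm)+
    also have "\<dots> = K2 * (\<Sum>k. (real k + 1) powr (1 - \<alpha>) * (A k)\<^sup>2)"
      by (rule suminf_mult[OF sm])
    finally have "(\<Sum>n<P. v n * (\<Sum>k. A k / (real n + real k + 1))\<^sup>2)
        \<le> K1 * (K2 * (\<Sum>k. (real k + 1) powr (1 - \<alpha>) * (A k)\<^sup>2))"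
      using K1(1) by (simp add: mult_left_mono)
    then show ?thesis using sm' by (simp add: mult_ac)
  qed
  show ?thesis
    by (rule that[of "K1 * K2"]) (use main K1(1) K2(1) in auto)
qed

subsection \<open>Boundedness on Dirichlet-type spaces\<close>

text \<open>Unlike in the norm of \<open>D2 \<gamma>\<close>, the weight is a function of \<open>n + 1\<close>, so that the constant
  coefficient needs no separate treatment.\<close>

definition weighted :: "real \<Rightarrow> (nat \<Rightarrow> complex) \<Rightarrow> nat \<Rightarrow> real" where
  "weighted \<gamma> c n = (real n + 1) powr (1 - \<gamma>) * (cmod (c n))\<^sup>2"

lemma weighted_nonneg [simp]: "0 \<le> weighted \<gamma> c n"
  by (simp add: weighted_def)

text \<open>Both weights agree up to the factor \<open>K\<close>, since
  \<open>max 1 n \<le> n + 1 \<le> 2 * max 1 n\<close>; statements about \<open>D2\<close> can thus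
  be passed to \<open>weighted\<close> and back.\<close>

lemma D2_weighted:
  fixes \<gamma> :: real
  defines "K \<equiv> 2 powr \<bar>1 - \<gamma>\<bar>"
  shows "h \<in> D2 \<gamma> \<longleftrightarrow> h holomorphic_on ball 0 1 \<and> summable (weighted \<gamma> (taylor_coeff h))"
    and "h \<in> D2 \<gamma> \<Longrightarrow> (D2_norm \<gamma> h)\<^sup>2 \<le> K * (\<Sum>n. weighted \<gamma> (taylor_coeff h) n)"
    and "h \<in> D2 \<gamma> \<Longrightarrow> (\<Sum>n. weighted \<gamma> (taylor_coeff h) n) \<le> K * (D2_norm \<gamma> h)\<^sup>2"
proof -
  define c where "c = taylor_coeff h"
  \<comment> \<open>With \<open>max 1 n\<close> the constant coefficient gets weight 1, so the
    squared norm is the single series \<open>suminf d\<close>.\<close>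
  define d where "d n = real (max 1 n) powr (1 - \<gamma>) * (cmod (c n))\<^sup>2" for n
  have cmp: "d n \<le> K * weighted \<gamma> c n" "weighted \<gamma> c n \<le> K * d n" for n
  proof -
    have "real (max 1 n) \<le> real n + 1" "real n + 1 \<le> 2 * real (max 1 n)" "0 < real (max 1 n)"
      by (auto simp: max_def)
    note pc = powr_comparable[OF this(3,1,2), of "1 - \<gamma>"]
    show "d n \<le> K * weighted \<gamma> c n" "weighted \<gamma> c n \<le> K * d n"
      unfolding d_def weighted_def K_def mult.assoc[symmetric] by (intro mult_right_mono pc; simp)+
  qed
  have d0: "0 \<le> d n" for n by (simp add: d_def)
  have iff: "summable d \<longleftrightarrow> summable (weighted \<gamma> c)"
  proof
    assume "summable d"
    then show "summable (weighted \<gamma> c)"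
      by (rule summable_comparison_test'[OF summable_mult[of d K], of 0]) (simp add: cmp(2))
  next
    assume "summable (weighted \<gamma> c)"
    then show "summable d"
      by (rule summable_comparison_test'[OF summable_mult[of "weighted \<gamma> c" K], of 0]) (simp add: cmp(1) d0)
  qed
  have dS: "d (Suc n) = real (Suc n) powr (1 - \<gamma>) * (cmod (taylor_coeff h (Suc n)))\<^sup>2" for n
    by (simp add: d_def c_def)
  have "h \<in> D2 \<gamma> \<longleftrightarrow> h holomorphic_on ball 0 1 \<and> summable (\<lambda>n. d (Suc n))"
    by (simp only: D2_def dS mem_Collect_eq)
  then show mem: "h \<in> D2 \<gamma> \<longleftrightarrow> h holomorphic_on ball 0 1 \<and> summable (weighted \<gamma> (taylor_coeff h))"
    using iff by (simp add: summable_Suc_iff c_def)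
  assume "h \<in> D2 \<gamma>"
  then have sm: "summable (weighted \<gamma> c)" "summable d" using mem iff by (auto simp: c_def)
  have smS: "summable (\<lambda>n. d (Suc n))" using sm(2) by (simp only: summable_Suc_iff)
  have "d 0 = (cmod (taylor_coeff h 0))\<^sup>2" by (simp add: d_def c_def)
  then have "D2_norm \<gamma> h = sqrt (d 0 + (\<Sum>n. d (Suc n)))"
    by (simp only: D2_norm_def dS)
  moreover have "0 \<le> d 0 + (\<Sum>n. d (Suc n))"
    by (intro add_nonneg_nonneg suminf_nonneg smS d0)
  ultimately have "(D2_norm \<gamma> h)\<^sup>2 = d 0 + (\<Sum>n. d (Suc n))"
    by (simp only: real_sqrt_pow2)
  then have norm_eq: "(D2_norm \<gamma> h)\<^sup>2 = suminf d"
    using suminf_split_head[OF sm(2)] by simp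
  have "suminf d \<le> (\<Sum>n. K * weighted \<gamma> c n)"
    by (intro suminf_le cmp sm summable_mult)
  then show "(D2_norm \<gamma> h)\<^sup>2 \<le> K * (\<Sum>n. weighted \<gamma> (taylor_coeff h) n)"
    using norm_eq sm(1) by (simp add: suminf_mult c_def)
  have "suminf (weighted \<gamma> c) \<le> (\<Sum>n. K * d n)"
    by (intro suminf_le cmp sm summable_mult)
  then show "(\<Sum>n. weighted \<gamma> (taylor_coeff h) n) \<le> K * (D2_norm \<gamma> h)\<^sup>2"
    using norm_eq sm(2) by (simp add: suminf_mult c_def)
qed

text \<open>The finitely many indices at which the asymptotic bound may fail are absorbed by adding
  their ratios \<open>\<bar>f n\<bar> / g n\<close> to the constant.\<close>

lemma bigo_nat_uniform:
  fixes f g :: "nat \<Rightarrow> real"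
  assumes "f \<in> O(g)" and g: "\<And>n. 0 < g n"
  obtains C where "0 \<le> C" "\<And>n. \<bar>f n\<bar> \<le> C * g n"
proof -
  obtain c where "c > 0" "eventually (\<lambda>n. norm (f n) \<le> c * norm (g n)) sequentially"
    using landau_o.bigE[OF assms(1)] by blast
  then obtain M where M: "\<And>n. n \<ge> M \<Longrightarrow> \<bar>f n\<bar> \<le> c * g n"
    using g by (auto simp: eventually_sequentially abs_of_pos)
  define C where "C = c + (\<Sum>n<M. \<bar>f n\<bar> / g n)"
  have nn: "0 \<le> \<bar>f n\<bar> / g n" for n using g[of n] by simp
  have "\<bar>f n\<bar> \<le> C * g n" for n
  proof (cases "n < M")
    case True
    have "\<bar>f n\<bar> / g n \<le> (\<Sum>n<M. \<bar>f n\<bar> / g n)"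
      using True nn by (intro member_le_sum) auto
    then have "\<bar>f n\<bar> / g n \<le> C" using \<open>c > 0\<close> by (simp add: C_def)
    then show ?thesis using g[of n] by (simp add: field_simps)
  next
    case False
    have "c \<le> C" using nn by (simp add: C_def sum_nonneg)
    then have "c * g n \<le> C * g n" using g[of n] by (intro mult_right_mono) auto
    then show ?thesis using M[of n] False by simp
  qed
  moreover have "0 \<le> C" using nn \<open>c > 0\<close> by (auto simp: C_def intro!: add_nonneg_nonneg sum_nonneg)
  ultimately show ?thesis using that by blast
qed

lemma D2_norm_nonneg: "h \<in> D2 \<gamma> \<Longrightarrow> 0 \<le> D2_norm \<gamma> h"
  by (auto simp: D2_norm_def D2_def intro!: add_nonneg_nonneg suminf_nonneg)

text \<open>The zero sequence in place of \<open>v\<close> reduces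
  \<open>hilbert_matrix_bound\<close> to its summability statement.\<close>

lemma summable_div_of_weighted:
  assumes "0 < \<alpha>" "\<alpha> < 2" "summable (weighted \<alpha> a)"
  shows "summable (\<lambda>k. cmod (a k) / (real n + real k + 1))"
proof -
  have block: "(\<Sum>n\<in>dyad N. 0 :: real) \<le> 0 * 2 powr (real N * (2 - \<alpha>))" for N by simp
  show ?thesis
    by (rule hilbert_matrix_bound[OF assms(1,2) order.refl block])
      (use assms(3) in \<open>auto simp: weighted_def[abs_def]\<close>)
qed

lemma norm_moment_le:
  assumes "summable (\<lambda>k. cmod (a k) / (real n + real k + 1))"
  shows "cmod (moment a n) \<le> (\<Sum>k. cmod (a k) / (real n + real k + 1))"
proof -
  have eq: "norm (a k / (of_nat n + of_nat k + 1)) = cmod (a k) / (real n + real k + 1)" for k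
  proof -
    have "of_nat n + of_nat k + 1 = complex_of_real (real n + real k + 1)" by simp
    then show ?thesis by (simp only: norm_divide norm_of_real abs_of_nonneg of_nat_0_le_iff add_nonneg_nonneg zero_le_one)
  qed
  show ?thesis
    unfolding moment_def using summable_norm[of "\<lambda>k. a k / (of_nat n + of_nat k + 1)"] assms
    by (simp add: eq)
qed

lemma taylor_coeff_hilbert_op:
  assumes g: "\<And>z. z \<in> ball 0 1 \<Longrightarrow> (\<lambda>n. b n * z ^ n) sums g z"
    and \<alpha>: "0 < \<alpha>" "\<alpha> < 2" and f: "f \<in> D2 \<alpha>"
  shows "hilbert_op g f holomorphic_on ball 0 1"
    and "taylor_coeff (hilbert_op g f) =
      (\<lambda>n. of_nat (Suc n) * b (Suc n) * moment (taylor_coeff f) n)"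
proof -
  have hol: "f holomorphic_on ball 0 1" and sm: "summable (weighted \<alpha> (taylor_coeff f))"
    using f by (auto simp: D2_weighted(1))
  have "summable (\<lambda>k. cmod (taylor_coeff f k) / (real k + 1))"
    using summable_div_of_weighted[OF \<alpha> sm, of 0] by simp
  note * = hilbert_op_sums[OF g taylor_coeff_sums[OF hol] this]
  show "hilbert_op g f holomorphic_on ball 0 1"
    and "taylor_coeff (hilbert_op g f) =
      (\<lambda>n. of_nat (Suc n) * b (Suc n) * moment (taylor_coeff f) n)"
    using taylor_coeff_unique[OF *] by auto
qed

text \<open>The factor \<open>n + 1\<close> from differentiating \<open>g\<close> is squared and
  raises the exponent from 1 - \<beta> to 3 - \<beta>.\<close>

lemma weighted_hilbert_op:
  "weighted \<beta> (\<lambda>n. of_nat (Suc n) * b (Suc n) * m n) n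
    = (real n + 1) powr (3 - \<beta>) * (cmod (b (n + 1)))\<^sup>2 * (cmod (m n))\<^sup>2"
proof -
  have "cmod (of_nat (Suc n)) = real n + 1"
    using norm_of_nat[of "Suc n", where 'a = complex] by simp
  moreover have "(real n + 1) powr (3 - \<beta>) = (real n + 1) powr (1 - \<beta>) * (real n + 1)\<^sup>2"
    using powr_add[of "real n + 1" "1 - \<beta>" 2] by simp
  ultimately show ?thesis
    by (simp add: weighted_def norm_mult power_mult_distrib)
qed

lemma dyad_weight_le:
  fixes f :: "nat \<Rightarrow> real"
  assumes "\<And>n. 0 \<le> f n"
  shows "(\<Sum>n\<in>dyad N. (real n + 1) powr p * f n) \<le> 2 powr \<bar>p\<bar> * 2 powr (real N * p) * (\<Sum>n\<in>dyad N. f n)"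
proof -
  have "(real n + 1) powr p \<le> 2 powr \<bar>p\<bar> * (2 ^ N) powr p" if "n \<in> dyad N" for n
    by (rule powr_comparable) (use dyadD[OF that] in auto)
  then have "(\<Sum>n\<in>dyad N. (real n + 1) powr p * f n) \<le> (\<Sum>n\<in>dyad N. 2 powr \<bar>p\<bar> * (2 ^ N) powr p * f n)"
    by (intro sum_mono mult_right_mono assms)
  then show ?thesis
    by (simp add: sum_distrib_left powr_realpow[symmetric] powr_powr)
qed

section \<open>Sufficiency of the block condition\<close>

text \<open>On block \<open>N\<close> the weight of exponent 3 - \<beta> combines with the bound of
  exponent \<beta> - \<alpha> - 1 to give 2 - \<alpha>, which is the growth allowed in
  \<open>hilbert_matrix_bound\<close>.\<close>

lemma bounded_if_coeff_bound:
  assumes g: "\<And>z. z \<in> ball 0 1 \<Longrightarrow> (\<lambda>n. b n * z ^ n) sums g z"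
    and \<alpha>: "0 < \<alpha>" "\<alpha> < 2"
    and C: "0 \<le> C" "\<And>N. (\<Sum>n\<in>dyad N. (cmod (b (n + 1)))\<^sup>2) \<le> C * 2 powr (real N * (\<beta> - \<alpha> - 1))"
  shows "bounded_D2_operator \<alpha> \<beta> (hilbert_op g)"
proof -
  define v where "v n = (real n + 1) powr (3 - \<beta>) * (cmod (b (n + 1)))\<^sup>2" for n
  define C' where "C' = 2 powr \<bar>3 - \<beta>\<bar> * C"
  have v0: "0 \<le> v n" for n by (simp add: v_def)
  have block: "(\<Sum>n\<in>dyad N. v n) \<le> C' * 2 powr (real N * (2 - \<alpha>))" for N
  proof -
    have "(\<Sum>n\<in>dyad N. v n)
        \<le> 2 powr \<bar>3 - \<beta>\<bar> * 2 powr (real N * (3 - \<beta>)) * (\<Sum>n\<in>dyad N. (cmod (b (n + 1)))\<^sup>2)"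
      unfolding v_def by (rule dyad_weight_le) simp
    also have "\<dots> \<le> 2 powr \<bar>3 - \<beta>\<bar> * 2 powr (real N * (3 - \<beta>)) * (C * 2 powr (real N * (\<beta> - \<alpha> - 1)))"
      by (intro mult_left_mono C) simp
    also have "\<dots> = C' * 2 powr (real N * (3 - \<beta>) + real N * (\<beta> - \<alpha> - 1))"
      unfolding powr_add by (simp only: C'_def mult_ac)
    also have "real N * (3 - \<beta>) + real N * (\<beta> - \<alpha> - 1) = real N * (2 - \<alpha>)"
      by (simp add: algebra_simps)
    finally show ?thesis .
  qed
  obtain K where K: "0 \<le> K"
    "\<And>A P. (\<And>k. 0 \<le> A k) \<Longrightarrow> summable (\<lambda>k. (real k + 1) powr (1 - \<alpha>) * (A k)\<^sup>2) \<Longrightarrow>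
      (\<Sum>n<P. v n * (\<Sum>k. A k / (real n + real k + 1))\<^sup>2)
        \<le> K * (\<Sum>k. (real k + 1) powr (1 - \<alpha>) * (A k)\<^sup>2)"
    by (rule hilbert_matrix_bound[OF \<alpha> v0 block]) blast
  \<comment> \<open>The outer powers of 2 convert between \<open>D2_norm\<close> and
    \<open>weighted\<close>. The estimates are for squared norms, so the operator bound is
    \<open>sqrt L\<close>.\<close>
  define L where "L = 2 powr \<bar>1 - \<beta>\<bar> * (K * 2 powr \<bar>1 - \<alpha>\<bar>)"
  have "hilbert_op g f \<in> D2 \<beta> \<and> D2_norm \<beta> (hilbert_op g f) \<le> sqrt L * D2_norm \<alpha> f"
    if f: "f \<in> D2 \<alpha>" for f
  proof -
    define a where "a = taylor_coeff f"
    define c where "c = taylor_coeff (hilbert_op g f)"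
    have sm: "summable (weighted \<alpha> a)" using f by (simp add: D2_weighted(1) a_def)
    have hol: "hilbert_op g f holomorphic_on ball 0 1"
      and c: "c = (\<lambda>n. of_nat (Suc n) * b (Suc n) * moment a n)"
      unfolding a_def c_def using taylor_coeff_hilbert_op[OF g \<alpha> f] by blast+
    have partial: "(\<Sum>n<P. weighted \<beta> c n) \<le> K * (\<Sum>k. weighted \<alpha> a k)" for P
    proof -
      have "(\<Sum>n<P. weighted \<beta> c n) = (\<Sum>n<P. v n * (cmod (moment a n))\<^sup>2)"
        using weighted_hilbert_op[of \<beta> b "moment a", folded c] by (simp only: v_def)
      also have "\<dots> \<le> (\<Sum>n<P. v n * (\<Sum>k. cmod (a k) / (real n + real k + 1))\<^sup>2)"
        by (intro sum_mono mult_left_mono power_mono norm_moment_le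
            summable_div_of_weighted[OF \<alpha> sm] v0) auto
      also have "\<dots> \<le> K * (\<Sum>k. weighted \<alpha> a k)"
        unfolding weighted_def by (rule K(2)) (use sm in \<open>auto simp: weighted_def[abs_def]\<close>)
      finally show ?thesis .
    qed
    have smc: "summable (weighted \<beta> c)"
      by (rule summableI_nonneg_bounded[OF _ partial]) simp
    then have mem: "hilbert_op g f \<in> D2 \<beta>"
      using hol by (simp add: D2_weighted(1) c_def)
    have "(D2_norm \<beta> (hilbert_op g f))\<^sup>2 \<le> 2 powr \<bar>1 - \<beta>\<bar> * (\<Sum>n. weighted \<beta> c n)"
      using D2_weighted(2)[OF mem] by (simp add: c_def)
    also have "\<dots> \<le> 2 powr \<bar>1 - \<beta>\<bar> * (K * (\<Sum>k. weighted \<alpha> a k))"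
      by (intro mult_left_mono suminf_le_const[OF smc partial]) simp
    also have "\<dots> \<le> 2 powr \<bar>1 - \<beta>\<bar> * (K * (2 powr \<bar>1 - \<alpha>\<bar> * (D2_norm \<alpha> f)\<^sup>2))"
      using D2_weighted(3)[OF f] K(1) by (intro mult_left_mono) (auto simp: a_def)
    finally have "(D2_norm \<beta> (hilbert_op g f))\<^sup>2 \<le> L * (D2_norm \<alpha> f)\<^sup>2"
      by (simp add: L_def mult_ac)
    then have "D2_norm \<beta> (hilbert_op g f) \<le> sqrt (L * (D2_norm \<alpha> f)\<^sup>2)"
      by (rule real_le_rsqrt)
    also have "\<dots> = sqrt L * D2_norm \<alpha> f"
      using D2_norm_nonneg[OF f] by (simp add: real_sqrt_mult)
    finally show ?thesis using mem by blast
  qed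
  then show ?thesis unfolding bounded_D2_operator_def by blast
qed

section \<open>Necessity of the block condition by testing on dyadic polynomials\<close>

definition dyad_poly :: "nat \<Rightarrow> complex \<Rightarrow> complex" where
  "dyad_poly N z = (\<Sum>k\<in>dyad N. z ^ k)"

lemma holomorphic_dyad_poly: "dyad_poly N holomorphic_on ball 0 1"
  and taylor_coeff_dyad_poly:
    "taylor_coeff (dyad_poly N) = (\<lambda>k. if k \<in> dyad N then 1 else 0)"
proof -
  have "(\<lambda>k. (if k \<in> dyad N then 1 else 0) * z ^ k) sums dyad_poly N z" for z
    using sums_If_finite_set[of "dyad N" "\<lambda>k. z ^ k"]
    by (simp add: dyad_poly_def if_distrib[of "\<lambda>x. x * _"] cong: if_cong)
  from taylor_coeff_unique[OF this] show "dyad_poly N holomorphic_on ball 0 1" and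
    "taylor_coeff (dyad_poly N) = (\<lambda>k. if k \<in> dyad N then 1 else 0)" by auto
qed

text \<open>There are \<open>2 ^ N\<close> coefficients equal to 1, each with a weight comparable to
  \<open>2 powr (N * (1 - \<alpha>))\<close>, uniformly in \<open>N\<close>.\<close>

lemma D2_norm_dyad_poly:
  obtains K where "0 \<le> K" "\<And>N. dyad_poly N \<in> D2 \<alpha>"
    "\<And>N. (D2_norm \<alpha> (dyad_poly N))\<^sup>2 \<le> K * 2 powr (real N * (2 - \<alpha>))"
proof -
  have w: "weighted \<alpha> (taylor_coeff (dyad_poly N)) =
      (\<lambda>k. if k \<in> dyad N then (real k + 1) powr (1 - \<alpha>) else 0)" for N
    by (auto simp: weighted_def taylor_coeff_dyad_poly fun_eq_iff)
  have mem: "dyad_poly N \<in> D2 \<alpha>" for N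
    by (simp add: D2_weighted(1) holomorphic_dyad_poly w)
  let ?K = "2 powr \<bar>1 - \<alpha>\<bar>"
  have "(D2_norm \<alpha> (dyad_poly N))\<^sup>2 \<le> ?K * ?K * 2 powr (real N * (2 - \<alpha>))" for N
  proof -
    have "(\<Sum>k. weighted \<alpha> (taylor_coeff (dyad_poly N)) k) = (\<Sum>k\<in>dyad N. (real k + 1) powr (1 - \<alpha>) * 1)"
      unfolding w
      using sums_unique[OF sums_If_finite_set[OF finite_dyad[of N], of "\<lambda>k. (real k + 1) powr (1 - \<alpha>)"]] by simp
    also have "\<dots> \<le> ?K * 2 powr (real N * (1 - \<alpha>)) * (\<Sum>k\<in>dyad N. 1)"
      by (rule dyad_weight_le) simp
    also have "\<dots> = ?K * (2 powr (real N * (1 - \<alpha>)) * 2 powr real N)"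
      by (simp add: powr_realpow)
    also have "\<dots> = ?K * 2 powr (real N * (2 - \<alpha>))"
      by (simp add: powr_add[symmetric] algebra_simps)
    finally have "?K * (\<Sum>k. weighted \<alpha> (taylor_coeff (dyad_poly N)) k)
        \<le> ?K * (?K * 2 powr (real N * (2 - \<alpha>)))"
      by (rule mult_left_mono) simp
    with D2_weighted(2)[OF mem]
    show ?thesis unfolding mult.assoc by (rule order_trans)
  qed
  then show ?thesis using that[of "?K * ?K"] mem by auto
qed

text \<open>The moment is a sum of \<open>2 ^ N\<close> positive terms with denominators at most
  \<open>4 * 2 ^ N\<close>. The range of \<open>n\<close> reaches the last index of the sum in the
  theorem.\<close>

lemma moment_dyad_poly_ge:
  assumes "n \<le> 2 ^ (N + 1)"
  shows "1 / 4 \<le> cmod (moment (taylor_coeff (dyad_poly N)) n)"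
proof -
  have "moment (taylor_coeff (dyad_poly N)) n = (\<Sum>k\<in>dyad N. 1 / (of_nat n + of_nat k + 1))"
    unfolding moment_def taylor_coeff_dyad_poly
    using sums_unique[OF sums_If_finite_set[OF finite_dyad[of N], of "\<lambda>k. 1 / (of_nat n + of_nat k + 1 :: complex)"]]
    by (simp add: if_distrib[of "\<lambda>x. x / _"] cong: if_cong)
  also have "\<dots> = of_real (\<Sum>k\<in>dyad N. 1 / (real n + real k + 1))" by simp
  finally have eq: "cmod (moment (taylor_coeff (dyad_poly N)) n) = \<bar>\<Sum>k\<in>dyad N. 1 / (real n + real k + 1)\<bar>"
    by (simp only: norm_of_real)
  have "1 / (4 * 2 ^ N) \<le> 1 / (real n + real k + 1)" if "k \<in> dyad N" for k
  proof -
    have "real n \<le> real (2 ^ (N + 1))" using assms by (simp only: of_nat_le_iff)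
    then have "real n \<le> 2 * 2 ^ N" by simp
    then have "real n + real k + 1 \<le> 4 * 2 ^ N" using dyadD(2)[OF that] by linarith
    then show ?thesis by (intro divide_left_mono) auto
  qed
  then have "(\<Sum>k\<in>dyad N. 1 / (4 * 2 ^ N)) \<le> (\<Sum>k\<in>dyad N. 1 / (real n + real k + 1))"
    by (rule sum_mono)
  then show ?thesis using eq by simp
qed

text \<open>Where the moments of \<open>dyad_poly N\<close> are at least 1/4, the coefficients of
  its image dominate those of \<open>g\<close>, while boundedness limits their weighted sum by
  \<open>2 powr (N * (2 - \<alpha>))\<close> up to a constant.\<close>

lemma coeff_bound_if_bounded:
  assumes g: "\<And>z. z \<in> ball 0 1 \<Longrightarrow> (\<lambda>n. b n * z ^ n) sums g z"
    and \<alpha>: "0 < \<alpha>" "\<alpha> < 2" and bd: "bounded_D2_operator \<alpha> \<beta> (hilbert_op g)"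
  obtains C where "\<And>N. (\<Sum>n = 2 ^ N - 1..2 ^ (N + 1). (cmod (b (n + 1)))\<^sup>2)
    \<le> C * 2 powr (real N * (\<beta> - \<alpha> - 1))"
proof -
  obtain C where mem: "\<And>f. f \<in> D2 \<alpha> \<Longrightarrow> hilbert_op g f \<in> D2 \<beta>"
    and C: "\<And>f. f \<in> D2 \<alpha> \<Longrightarrow> D2_norm \<beta> (hilbert_op g f) \<le> C * D2_norm \<alpha> f"
    using bd unfolding bounded_D2_operator_def by blast
  obtain K where K: "0 \<le> K" "\<And>N. dyad_poly N \<in> D2 \<alpha>"
    "\<And>N. (D2_norm \<alpha> (dyad_poly N))\<^sup>2 \<le> K * 2 powr (real N * (2 - \<alpha>))"
    using D2_norm_dyad_poly by blast
  define L where "L = 2 powr \<bar>1 - \<beta>\<bar> * C\<^sup>2 * K"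
  \<comment> \<open>The 16 compensates the square of the lower bound 1/4; the power of 4 compares
    \<open>n + 1\<close> with \<open>2 ^ N\<close>.\<close>
  define M where "M = 16 * 4 powr \<bar>3 - \<beta>\<bar> * L"
  have "(\<Sum>n = 2 ^ N - 1..2 ^ (N + 1). (cmod (b (n + 1)))\<^sup>2) \<le> M * 2 powr (real N * (\<beta> - \<alpha> - 1))" for N
  proof -
    define I where "I = {2 ^ N - 1..2 ^ (N + 1) :: nat}"
    define m where "m = moment (taylor_coeff (dyad_poly N))"
    define h where "h = hilbert_op g (dyad_poly N)"
    define X where "X = 2 powr (real N * (3 - \<beta>))"
    have h: "h \<in> D2 \<beta>" using mem K(2) by (simp add: h_def)
    have X: "0 < X" by (simp add: X_def)
    have coeff: "taylor_coeff h = (\<lambda>n. of_nat (Suc n) * b (Suc n) * m n)"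
      unfolding h_def m_def using taylor_coeff_hilbert_op(2)[OF g \<alpha> K(2)] by blast
    have w: "X * (cmod (b (n + 1)))\<^sup>2 \<le> 16 * 4 powr \<bar>3 - \<beta>\<bar> * weighted \<beta> (taylor_coeff h) n"
      if "n \<in> I" for n
    proof -
      \<comment> \<open>At the last index \<open>n + 1 = 2 * 2 ^ N + 1\<close>, so the comparison
        factor is 4, not the 2 of a block \<open>dyad N\<close>.\<close>
      have "2 ^ N \<le> n + 1" "n + 1 \<le> 4 * 2 ^ N"
      proof -
        have "2 ^ N - 1 \<le> n" "n \<le> 2 * 2 ^ N" using that by (auto simp: I_def)
        moreover have "1 \<le> (2::nat) ^ N" by simp
        ultimately show "2 ^ N \<le> n + 1" "n + 1 \<le> 4 * 2 ^ N" by linarith+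
      qed
      then have "real (2 ^ N) \<le> real (n + 1)" "real (n + 1) \<le> real (4 * 2 ^ N)"
        by (simp_all only: of_nat_le_iff)
      then have n: "2 ^ N \<le> real n + 1" "real n + 1 \<le> 4 * 2 ^ N" by simp_all
      have "(2 ^ N) powr (3 - \<beta>) \<le> 4 powr \<bar>3 - \<beta>\<bar> * (real n + 1) powr (3 - \<beta>)"
        by (rule powr_comparable(2)) (use n in auto)
      then have 1: "X \<le> 4 powr \<bar>3 - \<beta>\<bar> * (real n + 1) powr (3 - \<beta>)"
        by (simp add: X_def powr_realpow[symmetric] powr_powr)
      have "1 / 4 \<le> cmod (m n)"
        unfolding m_def by (rule moment_dyad_poly_ge) (use that in \<open>simp add: I_def\<close>)
      then have "(1 / 4)\<^sup>2 \<le> (cmod (m n))\<^sup>2" by (rule power_mono) simp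
      then have 2: "1 \<le> 16 * (cmod (m n))\<^sup>2" by (simp add: power2_eq_square)
      have "X * (cmod (b (n + 1)))\<^sup>2 * 1
          \<le> 4 powr \<bar>3 - \<beta>\<bar> * (real n + 1) powr (3 - \<beta>) * (cmod (b (n + 1)))\<^sup>2 * (16 * (cmod (m n))\<^sup>2)"
        by (intro mult_mono 1 2) auto
      also have "\<dots> = 16 * 4 powr \<bar>3 - \<beta>\<bar> * weighted \<beta> (taylor_coeff h) n"
        unfolding coeff weighted_hilbert_op by (simp only: mult_ac)
      finally show ?thesis by simp
    qed
    have "(\<Sum>n. weighted \<beta> (taylor_coeff h) n) \<le> L * 2 powr (real N * (2 - \<alpha>))"
    proof -
      have "(\<Sum>n. weighted \<beta> (taylor_coeff h) n) \<le> 2 powr \<bar>1 - \<beta>\<bar> * (D2_norm \<beta> h)\<^sup>2"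
        by (rule D2_weighted(3)[OF h])
      also have "\<dots> \<le> 2 powr \<bar>1 - \<beta>\<bar> * (C * D2_norm \<alpha> (dyad_poly N))\<^sup>2"
        using C[OF K(2)] D2_norm_nonneg[OF h] by (intro mult_left_mono power_mono) (auto simp: h_def)
      also have "\<dots> = 2 powr \<bar>1 - \<beta>\<bar> * C\<^sup>2 * (D2_norm \<alpha> (dyad_poly N))\<^sup>2"
        by (simp add: power_mult_distrib)
      also have "\<dots> \<le> 2 powr \<bar>1 - \<beta>\<bar> * C\<^sup>2 * (K * 2 powr (real N * (2 - \<alpha>)))"
        by (intro mult_left_mono K(3)) simp
      finally show ?thesis by (simp add: L_def)
    qed
    moreover have "(\<Sum>n\<in>I. weighted \<beta> (taylor_coeff h) n) \<le> (\<Sum>n. weighted \<beta> (taylor_coeff h) n)"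
      using h by (intro sum_le_suminf) (auto simp: D2_weighted(1) I_def)
    ultimately have "16 * 4 powr \<bar>3 - \<beta>\<bar> * (\<Sum>n\<in>I. weighted \<beta> (taylor_coeff h) n)
        \<le> 16 * 4 powr \<bar>3 - \<beta>\<bar> * (L * 2 powr (real N * (2 - \<alpha>)))"
      by (intro mult_left_mono) auto
    moreover have "X * (\<Sum>n\<in>I. (cmod (b (n + 1)))\<^sup>2)
        \<le> 16 * 4 powr \<bar>3 - \<beta>\<bar> * (\<Sum>n\<in>I. weighted \<beta> (taylor_coeff h) n)"
      unfolding sum_distrib_left by (rule sum_mono[OF w])
    ultimately have "X * (\<Sum>n\<in>I. (cmod (b (n + 1)))\<^sup>2) \<le> M * 2 powr (real N * (2 - \<alpha>))"
      unfolding M_def mult.assoc by (rule order_trans[rotated])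
    \<comment> \<open>Splitting the exponent exhibits the positive factor \<open>X\<close> on the
      right, where it cancels.\<close>
    also have "real N * (2 - \<alpha>) = real N * (3 - \<beta>) + real N * (\<beta> - \<alpha> - 1)"
      by (simp add: algebra_simps)
    also have "M * 2 powr \<dots> = X * (M * 2 powr (real N * (\<beta> - \<alpha> - 1)))"
      unfolding powr_add X_def by (simp only: mult_ac)
    finally show ?thesis using X by (simp add: I_def)
  qed
  then show ?thesis using that by blast
qed

theorem theorem2p2:
  fixes g :: "complex \<Rightarrow> complex" and b :: "nat \<Rightarrow> complex" and \<alpha> \<beta> :: real
  assumes "g holomorphic_on ball 0 1"
    and "\<And>z. z \<in> ball 0 1 \<Longrightarrow> (\<lambda>n. b n * z ^ n) sums g z"
    and "0 < \<alpha>" and "\<alpha> < 2"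
  shows "bounded_D2_operator \<alpha> \<beta> (hilbert_op g) \<longleftrightarrow>
    (\<lambda>N::nat. \<Sum>n = 2 ^ N - 1..2 ^ (N + 1). (cmod (b (n + 1)))\<^sup>2)
      \<in> O(\<lambda>N. 2 powr (real N * (\<beta> - \<alpha> - 1)))"
proof
  assume "bounded_D2_operator \<alpha> \<beta> (hilbert_op g)"
  then obtain C where C: "\<And>N. (\<Sum>n = 2 ^ N - 1..2 ^ (N + 1). (cmod (b (n + 1)))\<^sup>2)
      \<le> C * 2 powr (real N * (\<beta> - \<alpha> - 1))"
    using coeff_bound_if_bounded[OF assms(2-4)] by blast
  show "(\<lambda>N::nat. \<Sum>n = 2 ^ N - 1..2 ^ (N + 1). (cmod (b (n + 1)))\<^sup>2)
      \<in> O(\<lambda>N. 2 powr (real N * (\<beta> - \<alpha> - 1)))"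
    by (rule bigoI[of _ C], rule always_eventually) (use C in \<open>simp add: sum_nonneg\<close>)
next
  assume "(\<lambda>N::nat. \<Sum>n = 2 ^ N - 1..2 ^ (N + 1). (cmod (b (n + 1)))\<^sup>2)
      \<in> O(\<lambda>N. 2 powr (real N * (\<beta> - \<alpha> - 1)))"
  \<comment> \<open>The sufficiency argument sums over all blocks, so the bound is needed for every
    \<open>N\<close>, not only for large ones.\<close>
  then obtain C where C: "0 \<le> C"
    "\<And>N. \<bar>\<Sum>n = 2 ^ N - 1..2 ^ (N + 1). (cmod (b (n + 1)))\<^sup>2\<bar>
      \<le> C * 2 powr (real N * (\<beta> - \<alpha> - 1))"
    by (rule bigo_nat_uniform) (auto intro: that)
  have "(\<Sum>n\<in>dyad N. (cmod (b (n + 1)))\<^sup>2) \<le> C * 2 powr (real N * (\<beta> - \<alpha> - 1))" for N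
  proof -
    have "(\<Sum>n\<in>dyad N. (cmod (b (n + 1)))\<^sup>2) \<le> (\<Sum>n = 2 ^ N - 1..2 ^ (N + 1). (cmod (b (n + 1)))\<^sup>2)"
      by (rule sum_mono2) (auto simp: dyad_def)
    then show ?thesis using C(2)[of N] by linarith
  qed
  then show "bounded_D2_operator \<alpha> \<beta> (hilbert_op g)"
    using bounded_if_coeff_bound[OF assms(2-4) C(1)] by blast
qed

end
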